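(* Let the response counts $a_{T,1},a_{T,2},a_{C,1},a_{C,2}$ be independent and binomially distributed, $a_{T,i}\sim B(n_i,p_{T,i})$ and $a_{C,i}\sim B(k_i,p_{C,i})$ for $i=1,2$, with response probabilities $p_{T,1},p_{T,2},p_{C,1},p_{C,2}\notin\{0,1\}$. Let $n=n_1+n_2$ and $k=k_1+k_2$, and let $n_1,n_2,k_1,k_2$ and $k$ depend on $n$. Suppose that the null hypothesis of equal uplifts $$p_{T,1}-p_{C,1}=p_{T,2}-p_{C,2}$$ holds, and that the following regularity conditions hold: $$\lim_{n\to\infty}\frac{n_1}{n}=s>0,\qquad \lim_{n\to\infty}\frac{n_1}{k_1}=t_1>0,\qquad \lim_{n\to\infty}\frac{n_2}{k_2}=t_2>0.$$ Then the statistic $$\chi^2_{\mathrm{net}}=\left(\frac{(l_1-\hat e_1)^2}{\hat v_1}+\frac{(l_2-\hat e_2)^2}{\hat v_2}\right)\cdot\frac{1}{\hat w_n\hat f_n}$$ (with $l_i,\hat e_i,\hat v_i,\hat w_n,\hat f_n$ as defined in the context) follows, for $n\to\infty$, a $\chi^2$-distribution with one degree of freedom, i.e. it is asymptotically $\chi^2$-distributed with one degree of freedom.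
   Context: Setting: two campaigns (or two subgroups of one campaign) $i=1,2$, each with a target group (index $T$) of $n_i$ persons and a control group (index $C$) of $k_i$ persons. The random variable $a_{T,i}$ (resp. $a_{C,i}$) is the number of responses in the target (resp. control) group of subgroup $i$, and $p_{T,i}$ (resp. $p_{C,i}$) is the corresponding response probability. The uplift of subgroup $i$ is $p_{T,i}-p_{C,i}$. The total target size is $n=n_1+n_2$ and the total control size is $k=k_1+k_2$. Definitions, for $i=1,2$: Additional (uplift-based) responses: $l_i=a_{T,i}-\frac{n_i}{k_i}a_{C,i}$. Estimated response probabilities: $\hat p_{T,i}=\frac{a_{T,i}}{n_i}$, $\hat p_{C,i}=\frac{a_{C,i}}{k_i}$. Overall estimates (both weighted by target group sizes): $\hat p_T=\frac{n_1}{n}\hat p_{T,1}+\frac{n_2}{n}\hat p_{T,2}$ and $\hat p_C=\frac{n_1}{n}\hat p_{C,1}+\frac{n_2}{n}\hat p_{C,2}$. Estimated expectation of $l_i$ under the null hypothesis: $\hat e_i=n_i(\hat p_T-\hat p_C)$. Estimated variance of $l_i$: $\hat v_i=n_i\hat p_{T,i}(1-\hat p_{T,i})+\frac{n_i^2}{k_i}\hat p_{C,i}(1-\hat p_{C,i})$. Norming terms: $$\hat w_n=\frac{n_2}{n}\left[\hat p_{T,1}(1-\hat p_{T,1})+\frac{n_1}{k_1}\hat p_{C,1}(1-\hat p_{C,1})\right]+\frac{n_1}{n}\left[\hat p_{T,2}(1-\hat p_{T,2})+\frac{n_2}{k_2}\hat p_{C,2}(1-\hat p_{C,2})\right],$$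 $$\hat f_n=\frac{n_2/n}{\hat p_{T,1}(1-\hat p_{T,1})+\frac{n_1}{k_1}\hat p_{C,1}(1-\hat p_{C,1})}+\frac{n_1/n}{\hat p_{T,2}(1-\hat p_{T,2})+\frac{n_2}{k_2}\hat p_{C,2}(1-\hat p_{C,2})}.$$
   Formalization: The formal theorem also assumes n_2 → ∞ (automatic if s < 1); without it the claim fails for s = 1 with n_2 bounded, e.g. n_2 = k_2 = 2 and all response probabilities 1/2, where the limit has an atom at 0. *)

theory Defs
  imports "HOL-Probability.Probability"
begin

text \<open>The data of one observation: for each subgroup \<open>i \<in> {1, 2}\<close>, the size \<open>N i\<close> of the target
  group, the size \<open>K i\<close> of the control group, and the numbers \<open>aT i\<close>, \<open>aC i\<close> of responses in them.
  As division by zero yields zero, the quotients below agree with the usual ones only where their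
  denominators are nonzero; elsewhere they have no statistical meaning.\<close>

context
  fixes N K aT aC :: "nat \<Rightarrow> nat"
begin

definition add_responses :: "nat \<Rightarrow> real" where
  "add_responses i = real (aT i) - real (N i) / real (K i) * real (aC i)"

definition pT_hat :: "nat \<Rightarrow> real" where
  "pT_hat i = real (aT i) / real (N i)"

definition pC_hat :: "nat \<Rightarrow> real" where
  "pC_hat i = real (aC i) / real (K i)"

definition target_share :: "nat \<Rightarrow> real" where
  "target_share i = real (N i) / real (N 1 + N 2)"

definition pT_overall :: real where
  "pT_overall = target_share 1 * pT_hat 1 + target_share 2 * pT_hat 2"

text \<open>The control rates, too, are weighted by the sizes of the \<^emph>\<open>target\<close> groups.\<close>

definition pC_overall :: real where
  "pC_overall = target_share 1 * pC_hat 1 + target_share 2 * pC_hat 2"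

definition e_hat :: "nat \<Rightarrow> real" where
  "e_hat i = real (N i) * (pT_overall - pC_overall)"

definition v_hat :: "nat \<Rightarrow> real" where
  "v_hat i = real (N i) * pT_hat i * (1 - pT_hat i)
     + (real (N i))\<^sup>2 / real (K i) * pC_hat i * (1 - pC_hat i)"

definition unit_var_hat :: "nat \<Rightarrow> real" where
  "unit_var_hat i = pT_hat i * (1 - pT_hat i)
     + real (N i) / real (K i) * pC_hat i * (1 - pC_hat i)"

definition w_hat :: real where
  "w_hat = target_share 2 * unit_var_hat 1 + target_share 1 * unit_var_hat 2"

definition f_hat :: real where
  "f_hat = target_share 2 / unit_var_hat 1 + target_share 1 / unit_var_hat 2"

definition chi2_net :: real where
  "chi2_net = ((add_responses 1 - e_hat 1)\<^sup>2 / v_hat 1 + (add_responses 2 - e_hat 2)\<^sup>2 / v_hat 2)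
     * (1 / (w_hat * f_hat))"

end

text \<open>The chi-squared distribution with \<open>d\<close> degrees of freedom: the law of the sum of the squares
  of \<open>d\<close> independent standard normal variables.\<close>

definition chi_squared_distribution :: "nat \<Rightarrow> real measure" where
  "chi_squared_distribution d =
     distr (\<Pi>\<^sub>M j\<in>{..<d}. std_normal_distribution) borel (\<lambda>z. \<Sum>j<d. (z j)\<^sup>2)"

end

theory Submission
  imports Defs
begin

text \<open>
  Let \<open>d\<^sub>i\<close> be the estimated uplift of subgroup \<open>i\<close> and \<open>u\<^sub>i\<close> the bracket in the norming terms that
  belongs to it. As the overall uplift is the mean of \<open>d\<^sub>1\<close> and \<open>d\<^sub>2\<close> with weights \<open>n\<^sub>1/n\<close> and \<open>n\<^sub>2/n\<close>,
  both deviations \<open>l\<^sub>i - e\<^sub>i\<close> equal \<open>h (d\<^sub>1 - d\<^sub>2)\<close> up to sign, where \<open>h = n\<^sub>1 n\<^sub>2 / n\<close>; and the norming terms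
  are \<open>w = h (u\<^sub>1/n\<^sub>1 + u\<^sub>2/n\<^sub>2)\<close> and \<open>f = h (1/(n\<^sub>1 u\<^sub>1) + 1/(n\<^sub>2 u\<^sub>2))\<close>. The second factor of \<open>f\<close> is also
  the one that the two denominators \<open>v\<^sub>i = n\<^sub>i u\<^sub>i\<close> contribute, so it cancels, and the statistic is
  \<open>(d\<^sub>1 - d\<^sub>2)\<^sup>2 / (u\<^sub>1/n\<^sub>1 + u\<^sub>2/n\<^sub>2)\<close> (lemma \<open>chi2_net_eq_wald_statistic\<close>). This is the Wald statistic of
  a contrast: \<open>d\<^sub>1 - d\<^sub>2\<close> is a combination with coefficients \<open>\<plusminus>1\<close> of four independent relative
  frequencies, its mean vanishes under the null hypothesis, and the denominator is the plug-in
  estimate of its variance.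

  What remains is a general fact on finitely many independent binomial samples whose sizes tend to
  infinity (\<open>wald_statistic_weak_conv\<close>). The contrast divided by its exact standard deviation is
  asymptotically standard normal: its characteristic function is a finite product of powers, each of
  which is compared with a Gaussian factor, with an error bound that is uniform in the weights of the
  groups. The estimated variance divided by the exact one tends to 1 in probability, because every
  summand does so relative to its own size. The convergence of the Wald statistic then follows from
  the continuous mapping theorem for \<open>x \<mapsto> x\<^sup>2\<close> and Slutsky's theorem. The hypotheses on
  the group sizes make all four of them tend to infinity.
\<close>

section \<open>Operations that preserve weak convergence\<close>

text \<open>The continuous mapping theorem: composing a bounded continuous test function with \<open>g\<close> gives
  another one.\<close>
lemma weak_conv_m_distr_continuous:
  fixes g :: "real \<Rightarrow> real"
  assumes \<mu>: "\<And>n. real_distribution (\<mu> n)" and \<nu>: "real_distribution \<nu>"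
    and conv: "weak_conv_m \<mu> \<nu>" and g: "\<And>x. isCont g x"
  shows "weak_conv_m (\<lambda>n. distr (\<mu> n) borel g) (distr \<nu> borel g)"
proof -
  interpret \<mu>: real_distribution "\<mu> n" for n by fact
  interpret \<nu>: real_distribution \<nu> by fact
  have [measurable]: "g \<in> borel_measurable borel"
    using g by (intro borel_measurable_continuous_onI) (simp add: continuous_at_imp_continuous_on)
  show ?thesis
  proof (rule integral_bdd_continuous_conv_imp_weak_conv)
    fix f :: "real \<Rightarrow> real"
    assume f: "\<And>x. isCont f x" "\<And>x. \<bar>f x\<bar> \<le> 1"
    have [measurable]: "f \<in> borel_measurable borel"
      using f by (intro borel_measurable_continuous_onI) (simp add: continuous_at_imp_continuous_on)
    have "(\<lambda>n. integral\<^sup>L (\<mu> n) (\<lambda>x. f (g x))) \<longlonglongrightarrow> integral\<^sup>L \<nu> (\<lambda>x. f (g x))"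
      using f g by (intro weak_conv_imp_integral_bdd_continuous_conv[OF \<mu> \<nu> conv, where B = 1])
        (auto intro: isCont_o2)
    then show "(\<lambda>n. integral\<^sup>L (distr (\<mu> n) borel g) f) \<longlonglongrightarrow> integral\<^sup>L (distr \<nu> borel g) f"
      by (simp add: integral_distr)
  qed (auto intro: \<mu>.real_distribution_distr \<nu>.real_distribution_distr)
qed

lemma cdf_distr:
  assumes "X \<in> borel_measurable M"
  shows "cdf (distr M borel X) x = measure M {\<omega> \<in> space M. X \<omega> \<le> x}"
  using assms by (simp add: cdf_def measure_distr vimage_def Int_def conj_commute)

text \<open>Slutsky's theorem for quotients. While \<open>\<bar>R - 1\<bar> \<le> e\<close>, the conditions \<open>X / R \<le> x\<close> and \<open>X \<le> x\<close> differ
  only by a shift of the threshold by at most \<open>e \<bar>x\<bar>\<close>. The distribution function of \<open>X / R\<close> at \<open>x\<close> is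
  therefore squeezed between those of \<open>X\<close> at points just below and just above \<open>x\<close>; these can be
  chosen as continuity points of the limit, because a monotone function has only countably many
  discontinuities.\<close>
lemma weak_conv_m_divide:
  fixes X R :: "nat \<Rightarrow> 'a \<Rightarrow> real"
  assumes prob: "\<And>n. prob_space (M n)"
    and X[measurable]: "\<And>n. X n \<in> borel_measurable (M n)"
    and R[measurable]: "\<And>n. R n \<in> borel_measurable (M n)"
    and \<mu>: "real_distribution \<mu>"
    and conv: "weak_conv_m (\<lambda>n. distr (M n) borel (X n)) \<mu>"
    and R_1: "\<And>e. 0 < e \<Longrightarrow> (\<lambda>n. measure (M n) {\<omega> \<in> space (M n). e < \<bar>R n \<omega> - 1\<bar>}) \<longlonglongrightarrow> 0"
  shows "weak_conv_m (\<lambda>n. distr (M n) borel (\<lambda>\<omega>. X n \<omega> / R n \<omega>)) \<mu>"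
  unfolding weak_conv_m_def weak_conv_def
proof safe
  interpret prob_space "M n" for n by fact
  interpret \<mu>: real_distribution \<mu> by fact
  fix x assume x: "isCont (cdf \<mu>) x"
  let ?F = "cdf \<mu>"
  let ?bad = "\<lambda>e n. measure (M n) {\<omega> \<in> space (M n). e < \<bar>R n \<omega> - 1\<bar>}"
  have mono_F: "mono ?F" by (simp add: monoI \<mu>.cdf_nondecreasing)
  have conv_X: "(\<lambda>n. measure (M n) {\<omega> \<in> space (M n). X n \<omega> \<le> y}) \<longlonglongrightarrow> ?F y" if "isCont ?F y" for y
    using conv that by (simp add: weak_conv_m_def weak_conv_def cdf_distr)
  show "(\<lambda>n. cdf (distr (M n) borel (\<lambda>\<omega>. X n \<omega> / R n \<omega>)) x) \<longlonglongrightarrow> ?F x"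
    unfolding cdf_distr[OF borel_measurable_divide[OF X R]]
  proof (rule order_tendstoI)
    fix a assume a: "?F x < a"
    have "eventually (\<lambda>y. ?F y < a) (at x)"
      using x a by (auto simp: isCont_def intro: order_tendstoD)
    then obtain d where d: "d > 0" "\<And>y. y \<noteq> x \<Longrightarrow> dist y x < d \<Longrightarrow> ?F y < a"
      unfolding eventually_at by auto
    obtain y where y: "x < y" "y < x + d" "isCont ?F y"
      using open_minus_countable[OF mono_ctble_discont[OF mono_F], of "{x<..<x+d}"] d by auto
    \<comment> \<open>Less than 1, so that \<open>R\<close> is positive, and small enough that \<open>x R \<le> y\<close>; the summand 1 in the
      denominator covers \<open>x = 0\<close>.\<close>
    define e where "e = min (1/2) ((y - x) / (1 + \<bar>x\<bar>))"
    have e: "0 < e" "e < 1" using y by (auto simp: e_def)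
    have "e \<le> (y - x) / (1 + \<bar>x\<bar>)" by (simp add: e_def)
    then have "e + e * \<bar>x\<bar> \<le> y - x" by (simp add: pos_le_divide_eq distrib_left)
    then have ex: "e * \<bar>x\<bar> \<le> y - x" using e by simp
    have le: "measure (M n) {\<omega> \<in> space (M n). X n \<omega> / R n \<omega> \<le> x}
        \<le> measure (M n) {\<omega> \<in> space (M n). X n \<omega> \<le> y} + ?bad e n" for n
    proof -
      have "X n \<omega> \<le> y" if "X n \<omega> / R n \<omega> \<le> x" "\<not> e < \<bar>R n \<omega> - 1\<bar>" for \<omega>
      proof -
        have "0 < R n \<omega>" using that e by linarith
        then have "X n \<omega> \<le> x * R n \<omega>" using that by (simp add: divide_le_eq)
        also have "\<dots> = x + x * (R n \<omega> - 1)" by (simp add: algebra_simps)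
        also have "x * (R n \<omega> - 1) \<le> \<bar>x * (R n \<omega> - 1)\<bar>" by (rule abs_ge_self)
        also have "\<dots> \<le> \<bar>x\<bar> * e"
          unfolding abs_mult using that(2) by (intro mult_left_mono) simp_all
        finally show ?thesis using ex by (simp add: mult.commute)
      qed
      then have "measure (M n) {\<omega> \<in> space (M n). X n \<omega> / R n \<omega> \<le> x}
        \<le> measure (M n) ({\<omega> \<in> space (M n). X n \<omega> \<le> y} \<union> {\<omega> \<in> space (M n). e < \<bar>R n \<omega> - 1\<bar>})"
        by (intro finite_measure_mono) auto
      also have "\<dots> \<le> measure (M n) {\<omega> \<in> space (M n). X n \<omega> \<le> y} + ?bad e n"
        by (intro measure_Un_le) auto
      finally show ?thesis .
    qed
    have "(\<lambda>n. measure (M n) {\<omega> \<in> space (M n). X n \<omega> \<le> y} + ?bad e n) \<longlonglongrightarrow> ?F y + 0"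
      by (intro tendsto_add conv_X R_1 y e)
    moreover have "?F y + 0 < a" using d y by (simp add: dist_real_def)
    ultimately have "\<forall>\<^sub>F n in sequentially. measure (M n) {\<omega> \<in> space (M n). X n \<omega> \<le> y} + ?bad e n < a"
      by (rule order_tendstoD(2))
    then show "\<forall>\<^sub>F n in sequentially. measure (M n) {\<omega> \<in> space (M n). X n \<omega> / R n \<omega> \<le> x} < a"
      by (rule eventually_mono) (use le in \<open>blast intro: le_less_trans\<close>)
  next
    fix a assume a: "a < ?F x"
    have "eventually (\<lambda>y. a < ?F y) (at x)"
      using x a by (auto simp: isCont_def intro: order_tendstoD)
    then obtain d where d: "d > 0" "\<And>y. y \<noteq> x \<Longrightarrow> dist y x < d \<Longrightarrow> a < ?F y"
      unfolding eventually_at by auto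
    obtain y where y: "x - d < y" "y < x" "isCont ?F y"
      using open_minus_countable[OF mono_ctble_discont[OF mono_F], of "{x-d<..<x}"] d by auto
    define e where "e = min (1/2) ((x - y) / (1 + \<bar>x\<bar>))"
    have e: "0 < e" "e < 1" using y by (auto simp: e_def)
    have "e \<le> (x - y) / (1 + \<bar>x\<bar>)" by (simp add: e_def)
    then have "e + e * \<bar>x\<bar> \<le> x - y" by (simp add: pos_le_divide_eq distrib_left)
    then have ex: "e * \<bar>x\<bar> \<le> x - y" using e by simp
    have le: "measure (M n) {\<omega> \<in> space (M n). X n \<omega> \<le> y} - ?bad e n
        \<le> measure (M n) {\<omega> \<in> space (M n). X n \<omega> / R n \<omega> \<le> x}" for n
    proof -
      have "X n \<omega> / R n \<omega> \<le> x" if "X n \<omega> \<le> y" "\<not> e < \<bar>R n \<omega> - 1\<bar>" for \<omega>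
      proof -
        have R_pos: "0 < R n \<omega>" using that e by linarith
        have "- (x * (R n \<omega> - 1)) \<le> \<bar>x * (R n \<omega> - 1)\<bar>" by (rule abs_ge_minus_self)
        also have "\<dots> \<le> \<bar>x\<bar> * e"
          unfolding abs_mult using that(2) by (intro mult_left_mono) simp_all
        finally have "y \<le> x + x * (R n \<omega> - 1)" using ex by (simp add: mult.commute)
        also have "\<dots> = x * R n \<omega>" by (simp add: algebra_simps)
        finally show ?thesis using R_pos that by (simp add: divide_le_eq)
      qed
      then have "measure (M n) {\<omega> \<in> space (M n). X n \<omega> \<le> y}
        \<le> measure (M n) ({\<omega> \<in> space (M n). X n \<omega> / R n \<omega> \<le> x} \<union> {\<omega> \<in> space (M n). e < \<bar>R n \<omega> - 1\<bar>})"
        by (intro finite_measure_mono) auto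
      also have "\<dots> \<le> measure (M n) {\<omega> \<in> space (M n). X n \<omega> / R n \<omega> \<le> x} + ?bad e n"
        by (intro measure_Un_le) auto
      finally show ?thesis by simp
    qed
    have "(\<lambda>n. measure (M n) {\<omega> \<in> space (M n). X n \<omega> \<le> y} - ?bad e n) \<longlonglongrightarrow> ?F y - 0"
      by (intro tendsto_diff conv_X R_1 y e)
    moreover have "a < ?F y - 0" using d y by (simp add: dist_real_def)
    ultimately have "\<forall>\<^sub>F n in sequentially. a < measure (M n) {\<omega> \<in> space (M n). X n \<omega> \<le> y} - ?bad e n"
      by (rule order_tendstoD(1))
    then show "\<forall>\<^sub>F n in sequentially. a < measure (M n) {\<omega> \<in> space (M n). X n \<omega> / R n \<omega> \<le> x}"
      by (rule eventually_mono) (use le in \<open>blast intro: less_le_trans\<close>)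
  qed
qed

lemma weak_conv_m_cong_eventually:
  assumes "\<forall>\<^sub>F n in sequentially. \<mu> n = \<mu>' n" and "weak_conv_m \<mu>' \<nu>"
  shows "weak_conv_m \<mu> \<nu>"
  unfolding weak_conv_m_def weak_conv_def
proof (intro allI impI)
  fix x assume "isCont (cdf \<nu>) x"
  then have "(\<lambda>n. cdf (\<mu>' n) x) \<longlonglongrightarrow> cdf \<nu> x"
    using assms by (simp add: weak_conv_m_def weak_conv_def)
  then show "(\<lambda>n. cdf (\<mu> n) x) \<longlonglongrightarrow> cdf \<nu> x"
    by (rule Lim_transform_eventually) (use assms(1) in \<open>auto elim: eventually_mono\<close>)
qed

section \<open>Gaussian approximation of binomial characteristic functions\<close>

lemma iexp_quadratic_approx:
  "cmod (iexp x - (1 + \<i> * x - complex_of_real (x\<^sup>2 / 2))) \<le> \<bar>x\<bar> ^ 3 / 6"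
proof -
  have "(\<Sum>k\<le>2. (\<i> * x)^k / fact k) = 1 + \<i> * x - complex_of_real (x\<^sup>2 / 2)"
    by (simp add: numeral_2_eq_2 power_mult_distrib)
  then show ?thesis
    using iexp_approx1[of x 2] by (simp add: eval_nat_numeral fact_numeral)
qed

lemma exp_minus_linear_approx:
  fixes x :: real
  assumes "0 \<le> x"
  shows "\<bar>exp (- x) - (1 - x)\<bar> \<le> x\<^sup>2 / 2"
proof -
  have pos: "1 + x + x\<^sup>2 / 2 > 0" using assms by (intro add_pos_nonneg) auto
  have "exp (- x) \<le> 1 / (1 + x + x\<^sup>2 / 2)"
    using exp_lower_Taylor_quadratic[OF assms] pos
    by (simp add: exp_minus inverse_eq_divide frac_le)
  also have "\<dots> \<le> 1 - x + x\<^sup>2 / 2"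
  proof -
    have "(1 - x + x\<^sup>2 / 2) * (1 + x + x\<^sup>2 / 2) = 1 + (x\<^sup>2 / 2)\<^sup>2"
      by (simp add: power2_eq_square field_simps)
    then show ?thesis using pos by (simp add: divide_le_eq)
  qed
  finally have "exp (- x) - (1 - x) \<le> x\<^sup>2 / 2" by simp
  moreover have "1 - x \<le> exp (- x)" using exp_ge_add_one_self[of "- x"] by simp
  ultimately show ?thesis by (simp add: abs_le_iff)
qed

text \<open>The characteristic function at \<open>\<theta>\<close> of \<open>B - p\<close>, where \<open>B\<close> has the Bernoulli distribution with
  parameter \<open>p\<close>.\<close>
definition centered_bernoulli_char :: "real \<Rightarrow> real \<Rightarrow> complex" where
  "centered_bernoulli_char p \<theta> = (1 - p) * iexp (- (\<theta> * p)) + p * iexp (\<theta> * (1 - p))"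

text \<open>Both functions agree up to second order with \<open>1 - p (1 - p) \<theta>\<^sup>2 / 2\<close>: the linear terms of the two
  exponentials cancel because the variable is centred, and the quadratic ones add up to its variance.\<close>
lemma centered_bernoulli_char_approx:
  assumes "p \<in> {0..1}"
  shows "cmod (centered_bernoulli_char p \<theta> - exp (- (p * (1 - p) * \<theta>\<^sup>2 / 2)))
    \<le> p * (1 - p) * \<bar>\<theta>\<bar> ^ 3 / 6 + (p * (1 - p) * \<theta>\<^sup>2)\<^sup>2 / 8"
proof -
  define q where "q = 1 - p"
  define A where "A x = iexp x - (1 + \<i> * complex_of_real x - complex_of_real (x\<^sup>2 / 2))" for x
  have pq: "0 \<le> p" "0 \<le> q" "p + q = 1" using assms by (auto simp: q_def)
  have "p\<^sup>2 + q\<^sup>2 = (p + q)\<^sup>2 - 2 * (p * q)" by (simp add: power2_eq_square algebra_simps)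
  then have sq: "p\<^sup>2 + q\<^sup>2 \<le> 1" using pq by simp
  let ?x = "p * q * \<theta>\<^sup>2 / 2"
  have x: "0 \<le> ?x" using pq by simp
  have var: "q * p\<^sup>2 + p * q\<^sup>2 = p * q"
  proof -
    have "q * p\<^sup>2 + p * q\<^sup>2 = p * q * (p + q)" by (simp add: power2_eq_square algebra_simps)
    then show ?thesis using pq by simp
  qed
  have "complex_of_real q + complex_of_real p = 1" using pq by (metis add.commute of_real_1 of_real_add)
  then have "centered_bernoulli_char p \<theta> - complex_of_real (1 - ?x)
      = q * A (- (\<theta> * p)) + p * A (\<theta> * q)
        + complex_of_real (?x - (q * p\<^sup>2 + p * q\<^sup>2) * \<theta>\<^sup>2 / 2)"
    unfolding centered_bernoulli_char_def A_def q_def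
    by (simp add: algebra_simps power2_eq_square add_divide_distrib diff_divide_distrib)
  then have "centered_bernoulli_char p \<theta> - complex_of_real (1 - ?x) = q * A (- (\<theta> * p)) + p * A (\<theta> * q)"
    using var by simp
  then have "cmod (centered_bernoulli_char p \<theta> - complex_of_real (1 - ?x))
      \<le> q * cmod (A (- (\<theta> * p))) + p * cmod (A (\<theta> * q))"
    using pq by (simp add: norm_triangle_le norm_mult)
  also have "\<dots> \<le> q * (\<bar>- (\<theta> * p)\<bar> ^ 3 / 6) + p * (\<bar>\<theta> * q\<bar> ^ 3 / 6)"
    unfolding A_def using pq by (intro add_mono mult_left_mono iexp_quadratic_approx) auto
  also have "\<dots> = p * q * \<bar>\<theta>\<bar> ^ 3 / 6 * (p\<^sup>2 + q\<^sup>2)"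
    using pq by (simp add: abs_mult power_mult_distrib field_simps power2_eq_square power3_eq_cube)
  also have "\<dots> \<le> p * q * \<bar>\<theta>\<bar> ^ 3 / 6"
    using sq pq by (intro mult_left_le) auto
  finally have 1: "cmod (centered_bernoulli_char p \<theta> - complex_of_real (1 - ?x)) \<le> p * q * \<bar>\<theta>\<bar> ^ 3 / 6" .
  have "cmod (complex_of_real (1 - ?x) - exp (- ?x)) = \<bar>exp (- ?x) - (1 - ?x)\<bar>"
    by (metis abs_minus_commute norm_of_real of_real_diff)
  also have "\<dots> \<le> (p * q * \<theta>\<^sup>2)\<^sup>2 / 8"
    using exp_minus_linear_approx[OF x] by (simp add: power_divide)
  finally have 2: "cmod (complex_of_real (1 - ?x) - exp (- ?x)) \<le> (p * q * \<theta>\<^sup>2)\<^sup>2 / 8" .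
  show ?thesis
    using norm_triangle_le[OF add_mono[OF 1 2]] by (simp add: q_def)
qed

lemma norm_centered_bernoulli_char_le_1:
  assumes "p \<in> {0..1}"
  shows "cmod (centered_bernoulli_char p \<theta>) \<le> 1"
proof -
  have n: "cmod (1 - complex_of_real p) = 1 - p"
    using assms by (metis abs_of_nonneg atLeastAtMost_iff diff_ge_0_iff_ge norm_of_real of_real_1 of_real_diff)
  show ?thesis
    unfolding centered_bernoulli_char_def
    by (rule order_trans[OF norm_triangle_ineq]) (use assms n in \<open>simp add: norm_mult flip: of_real_mult of_real_minus\<close>)
qed

lemma char_centered_binomial:
  assumes p: "p \<in> {0..1}" and [measurable]: "A \<in> measurable M (count_space UNIV)"
    and A: "distr M (count_space UNIV) A = measure_pmf (binomial_pmf m p)"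
  shows "char (distr M borel (\<lambda>\<omega>. b * (real (A \<omega>) - m * p))) t = centered_bernoulli_char p (t * b) ^ m"
proof -
  let ?f = "\<lambda>k::nat. iexp (t * (b * (real k - m * p)))"
  have "char (distr M borel (\<lambda>\<omega>. b * (real (A \<omega>) - m * p))) t = (LINT \<omega>|M. ?f (A \<omega>))"
    unfolding char_def by (subst integral_distr) auto
  also have "\<dots> = (LINT k|distr M (count_space UNIV) A. ?f k)"
    by (subst integral_distr) auto
  also have "\<dots> = (\<Sum>k\<le>m. (real (m choose k) * p ^ k * (1 - p) ^ (m - k)) *\<^sub>R ?f k)"
    unfolding A using p by (rule expectation_binomial_pmf')
  also have "\<dots> = (\<Sum>k\<le>m. of_nat (m choose k) * (p * iexp (t * b * (1 - p))) ^ k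
      * ((1 - p) * iexp (- (t * b * p))) ^ (m - k))"
  proof (intro sum.cong refl)
    fix k assume "k \<in> {..m}"
    then have "?f k = iexp (t * b * (1 - p)) ^ k * iexp (- (t * b * p)) ^ (m - k)"
      by (simp add: exp_of_nat_mult[symmetric] exp_add[symmetric] of_nat_diff algebra_simps)
    then show "(real (m choose k) * p ^ k * (1 - p) ^ (m - k)) *\<^sub>R ?f k
        = of_nat (m choose k) * (p * iexp (t * b * (1 - p))) ^ k
          * ((1 - p) * iexp (- (t * b * p))) ^ (m - k)"
      by (simp add: scaleR_conv_of_real power_mult_distrib)
  qed
  also have "\<dots> = centered_bernoulli_char p (t * b) ^ m"
    unfolding centered_bernoulli_char_def
    by (subst add.commute) (simp add: binomial_ring)
  finally show ?thesis .
qed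

text \<open>The one-step error is multiplied by at most \<open>m\<close> when the \<open>m\<close>-th powers of two numbers in the unit
  disc are compared. The hypothesis makes \<open>\<theta>\<close> of order at most \<open>1 / sqrt m\<close>, so that the cubic error,
  thus multiplied, is still of order \<open>1 / sqrt m\<close>. The bound depends on \<open>\<theta>\<close> only
  through \<open>t\<close>, which makes it uniform in the weight with which a sample enters a contrast.\<close>
lemma centered_bernoulli_char_power_approx:
  assumes p: "0 < p" "p < 1" and \<theta>: "m * (p * (1 - p)) * \<theta>\<^sup>2 \<le> t\<^sup>2"
  shows "cmod (centered_bernoulli_char p \<theta> ^ m - complex_of_real (exp (- (m * (p * (1 - p)) * \<theta>\<^sup>2 / 2))))
    \<le> \<bar>t\<bar> ^ 3 / (6 * sqrt (m * (p * (1 - p)))) + t ^ 4 / (8 * real m)"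
proof (cases "m = 0")
  case True
  then show ?thesis by simp
next
  case False
  define v where "v = p * (1 - p)"
  have v: "0 < v" using p by (simp add: v_def)
  have m: "0 < real m" using False by simp
  define r where "r = sqrt (m * v)"
  have r: "0 < r" "m * v = r\<^sup>2" using v m by (auto simp: r_def)
  have "\<bar>r * \<theta>\<bar> \<le> \<bar>t\<bar>"
    using \<theta> unfolding v_def[symmetric] r(2) by (simp add: power_mult_distrib[symmetric] abs_le_square_iff)
  then have "(r * \<bar>\<theta>\<bar>) ^ 3 \<le> \<bar>t\<bar> ^ 3"
    using r by (intro power_mono) (auto simp: abs_mult)
  then have 1: "r\<^sup>2 * \<bar>\<theta>\<bar> ^ 3 / 6 \<le> \<bar>t\<bar> ^ 3 / (6 * r)"
    using r by (simp add: field_simps power2_eq_square power3_eq_cube)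
  have "(m * v * \<theta>\<^sup>2)\<^sup>2 \<le> (t\<^sup>2)\<^sup>2"
    using \<theta> v by (intro power_mono) (auto simp: v_def)
  then have 2: "m * ((v * \<theta>\<^sup>2)\<^sup>2 / 8) \<le> t ^ 4 / (8 * real m)"
    using m by (simp add: field_simps power2_eq_square eval_nat_numeral)
  have "exp (- (m * v * \<theta>\<^sup>2 / 2)) = exp (- (v * \<theta>\<^sup>2 / 2)) ^ m"
    by (simp add: exp_of_nat_mult[symmetric])
  then have "cmod (centered_bernoulli_char p \<theta> ^ m - complex_of_real (exp (- (m * v * \<theta>\<^sup>2 / 2))))
      = cmod (centered_bernoulli_char p \<theta> ^ m - complex_of_real (exp (- (v * \<theta>\<^sup>2 / 2))) ^ m)"
    by simp
  also have "\<dots> \<le> m * cmod (centered_bernoulli_char p \<theta> - complex_of_real (exp (- (v * \<theta>\<^sup>2 / 2))))"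
    using p v by (intro norm_power_diff norm_centered_bernoulli_char_le_1) auto
  also have "\<dots> \<le> m * (v * \<bar>\<theta>\<bar> ^ 3 / 6 + (v * \<theta>\<^sup>2)\<^sup>2 / 8)"
    unfolding v_def using p by (intro mult_left_mono centered_bernoulli_char_approx) auto
  also have "\<dots> = r\<^sup>2 * \<bar>\<theta>\<bar> ^ 3 / 6 + m * ((v * \<theta>\<^sup>2)\<^sup>2 / 8)"
    unfolding r(2)[symmetric] by (simp add: algebra_simps)
  also have "\<dots> \<le> \<bar>t\<bar> ^ 3 / (6 * r) + t ^ 4 / (8 * real m)"
    using 1 2 by (rule add_mono)
  finally show ?thesis unfolding r_def v_def .
qed

section \<open>Wald statistics of independent binomial samples\<close>

lemma chi_squared_distribution_1:
  "chi_squared_distribution 1 = distr std_normal_distribution borel (\<lambda>z. z\<^sup>2)"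
proof -
  interpret real_distribution std_normal_distribution by (rule real_dist_normal_dist)
  let ?P = "\<Pi>\<^sub>M j\<in>{..<1::nat}. std_normal_distribution"
  have "distr ?P std_normal_distribution (\<lambda>z. z 0) = std_normal_distribution"
    by (rule distr_PiM_component) (auto intro: prob_space_axioms)
  then have "distr std_normal_distribution borel (\<lambda>z. z\<^sup>2)
      = distr (distr ?P std_normal_distribution (\<lambda>z. z 0)) borel (\<lambda>z. z\<^sup>2)" by simp
  also have "\<dots> = distr ?P borel (\<lambda>z. (z 0)\<^sup>2)"
    by (subst distr_distr) (auto simp: comp_def)
  finally show ?thesis by (simp add: chi_squared_distribution_def)
qed

text \<open>A sequence of experiments, each with one binomial count for every group \<open>i \<in> J\<close>. The experiments
  may live on different probability spaces.\<close>
locale binomial_samples =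
  fixes M :: "nat \<Rightarrow> 'a measure" and J :: "'i set"
    and A :: "'i \<Rightarrow> nat \<Rightarrow> 'a \<Rightarrow> nat" and m :: "'i \<Rightarrow> nat \<Rightarrow> nat" and p :: "'i \<Rightarrow> real"
  assumes prob: "\<And>n. prob_space (M n)"
    and finite_J: "finite J"
    and indep: "\<And>n. prob_space.indep_vars (M n) (\<lambda>_. count_space UNIV) (\<lambda>i. A i n) J"
    and binomial: "\<And>i n. i \<in> J \<Longrightarrow>
      distr (M n) (count_space UNIV) (A i n) = measure_pmf (binomial_pmf (m i n) (p i))"
    and p: "\<And>i. i \<in> J \<Longrightarrow> 0 < p i \<and> p i < 1"
    and m_unbounded: "\<And>i. i \<in> J \<Longrightarrow> filterlim (m i) at_top sequentially"
begin

lemma measurable_A [measurable]: "i \<in> J \<Longrightarrow> A i n \<in> measurable (M n) (count_space UNIV)"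
  using indep[of n] by (simp add: prob_space.indep_vars_def2[OF prob])

definition phat :: "'i \<Rightarrow> nat \<Rightarrow> 'a \<Rightarrow> real" where
  "phat i n \<omega> = real (A i n \<omega>) / real (m i n)"

lemma measurable_phat [measurable]: "i \<in> J \<Longrightarrow> phat i n \<in> borel_measurable (M n)"
  unfolding phat_def by measurable

text \<open>The variance of \<open>\<Sum>i\<in>J. c i * phat i n\<close>.\<close>
definition contrast_var :: "('i \<Rightarrow> real) \<Rightarrow> nat \<Rightarrow> real" where
  "contrast_var c n = (\<Sum>i\<in>J. (c i)\<^sup>2 * (p i * (1 - p i)) / real (m i n))"

definition contrast_var_hat :: "('i \<Rightarrow> real) \<Rightarrow> nat \<Rightarrow> 'a \<Rightarrow> real" where
  "contrast_var_hat c n \<omega> = (\<Sum>i\<in>J. (c i)\<^sup>2 * (phat i n \<omega> * (1 - phat i n \<omega>)) / real (m i n))"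

lemma measurable_contrast_var_hat [measurable]: "contrast_var_hat c n \<in> borel_measurable (M n)"
  unfolding contrast_var_hat_def by measurable

lemma real_m_unbounded: "i \<in> J \<Longrightarrow> filterlim (\<lambda>n. real (m i n)) at_top sequentially"
  by (rule filterlim_compose[OF filterlim_real_sequentially m_unbounded])

lemma eventually_m_pos: "\<forall>\<^sub>F n in sequentially. \<forall>i\<in>J. 0 < m i n"
  using finite_J
proof (rule eventually_ball_finite, safe)
  fix i assume "i \<in> J"
  then have "\<forall>\<^sub>F n in sequentially. 1 \<le> m i n"
    using m_unbounded by (simp add: filterlim_at_top)
  then show "\<forall>\<^sub>F n in sequentially. 0 < m i n" by eventually_elim simp
qed

lemma variance_pos: "i \<in> J \<Longrightarrow> 0 < p i * (1 - p i)"
  using p by simp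

lemma measure_A:
  assumes "i \<in> J"
  shows "measure (M n) {\<omega> \<in> space (M n). P (A i n \<omega>)} = measure_pmf.prob (binomial_pmf (m i n) (p i)) {k. P k}"
proof -
  have "measure (distr (M n) (count_space UNIV) (A i n)) {k. P k} = measure (M n) {\<omega> \<in> space (M n). P (A i n \<omega>)}"
    using assms by (subst measure_distr) (auto simp: vimage_def Int_def conj_commute)
  then show ?thesis using binomial[OF assms] by simp
qed

lemma AE_A_le:
  assumes "i \<in> J"
  shows "AE \<omega> in M n. A i n \<omega> \<le> m i n"
proof -
  have "AE k in measure_pmf (binomial_pmf (m i n) (p i)). k \<le> m i n"
    using p[OF assms] by (simp add: AE_measure_pmf_iff)
  then have "AE k in distr (M n) (count_space UNIV) (A i n). k \<le> m i n"
    unfolding binomial[OF assms] .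
  then show ?thesis
    using assms by (subst (asm) AE_distr_iff) auto
qed

text \<open>The weak law of large numbers, with the rate that Hoeffding's inequality provides.\<close>
lemma phat_tendsto_in_prob:
  assumes i: "i \<in> J" and e: "0 < e"
  shows "(\<lambda>n. measure (M n) {\<omega> \<in> space (M n). e \<le> \<bar>phat i n \<omega> - p i\<bar>}) \<longlonglongrightarrow> 0"
proof (rule tendsto_sandwich[OF _ _ tendsto_const])
  show "\<forall>\<^sub>F n in sequentially. measure (M n) {\<omega> \<in> space (M n). e \<le> \<bar>phat i n \<omega> - p i\<bar>}
      \<le> 2 * exp (- 2 * real (m i n) * e\<^sup>2)"
    using eventually_m_pos
  proof eventually_elim
    case (elim n)
    interpret binomial_distribution "m i n" "p i" using p[OF i] by unfold_locales auto
    show ?case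
      unfolding phat_def measure_A[OF i, of _ "\<lambda>k. e \<le> \<bar>real k / real (m i n) - p i\<bar>"]
      using prob_abs_ge'[of e] e elim i by simp
  qed
  show "(\<lambda>n. 2 * exp (- 2 * real (m i n) * e\<^sup>2)) \<longlonglongrightarrow> 0"
  proof -
    have "filterlim (\<lambda>n. 2 * e\<^sup>2 * real (m i n)) at_top sequentially"
      using e by (intro filterlim_tendsto_pos_mult_at_top[OF tendsto_const] real_m_unbounded i) auto
    then have "(\<lambda>n. exp (- (2 * e\<^sup>2 * real (m i n)))) \<longlonglongrightarrow> 0"
      by (intro filterlim_compose[OF exp_at_bot] filterlim_compose[OF filterlim_uminus_at_bot_at_top])
    from tendsto_mult_right_zero[OF this, of 2] show ?thesis by (simp add: mult_ac)
  qed
qed simp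

lemma contrast_var_pos:
  assumes "J \<noteq> {}" "\<And>i. i \<in> J \<Longrightarrow> c i \<noteq> 0" "\<And>i. i \<in> J \<Longrightarrow> 0 < m i n"
  shows "0 < contrast_var c n"
  unfolding contrast_var_def
  using assms finite_J variance_pos by (intro sum_pos) (auto intro!: divide_pos_pos mult_pos_pos)

text \<open>The weights \<open>(c i)\<^sup>2 / m i n\<close> in the variance are arbitrary positive numbers that may be of different
  orders, so the comparison is made summand by summand: if each estimated Bernoulli variance is
  within a relative error \<open>e\<close> of the true one, then so is the weighted sum. By the identity
  \<open>x (1 - x) - y (1 - y) = (x - y) (1 - x - y)\<close>, an error of a frequency is not enlarged by the
  passage to the Bernoulli variance.\<close>
lemma contrast_var_ratio_tendsto_1:
  assumes J: "J \<noteq> {}" and c: "\<And>i. i \<in> J \<Longrightarrow> c i \<noteq> 0" and e: "0 < e"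
  shows "(\<lambda>n. measure (M n) {\<omega> \<in> space (M n). e < \<bar>contrast_var_hat c n \<omega> / contrast_var c n - 1\<bar>}) \<longlonglongrightarrow> 0"
proof -
  define d where "d i = e * (p i * (1 - p i))" for i
  have d: "0 < d i" if "i \<in> J" for i using variance_pos[OF that] e by (simp add: d_def)
  let ?dev = "\<lambda>i n. {\<omega> \<in> space (M n). d i \<le> \<bar>phat i n \<omega> - p i\<bar>}"
  have bound: "measure (M n) {\<omega> \<in> space (M n). e < \<bar>contrast_var_hat c n \<omega> / contrast_var c n - 1\<bar>}
      \<le> (\<Sum>i\<in>J. measure (M n) (?dev i n))" if m: "\<forall>i\<in>J. 0 < m i n" for n
  proof -
    interpret prob_space "M n" by (rule prob)
    have V: "0 < contrast_var c n" using J c m by (intro contrast_var_pos) auto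
    have close: "\<bar>contrast_var_hat c n \<omega> / contrast_var c n - 1\<bar> \<le> e"
      if le: "\<forall>i\<in>J. A i n \<omega> \<le> m i n" and dev: "\<forall>i\<in>J. \<bar>phat i n \<omega> - p i\<bar> < d i" for \<omega>
    proof -
      have "\<bar>contrast_var_hat c n \<omega> - contrast_var c n\<bar>
          = \<bar>\<Sum>i\<in>J. (c i)\<^sup>2 / m i n * (phat i n \<omega> * (1 - phat i n \<omega>) - p i * (1 - p i))\<bar>"
        unfolding contrast_var_hat_def contrast_var_def sum_subtractf[symmetric]
        by (intro arg_cong[where f = abs] sum.cong) (auto simp: algebra_simps diff_divide_distrib)
      also have "\<dots> \<le> (\<Sum>i\<in>J. (c i)\<^sup>2 / m i n * d i)"
      proof (rule order_trans[OF sum_abs], rule sum_mono)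
        fix i assume i: "i \<in> J"
        have ph: "0 \<le> phat i n \<omega>" "phat i n \<omega> \<le> 1"
          using le m i by (auto simp: phat_def)
        have "phat i n \<omega> * (1 - phat i n \<omega>) - p i * (1 - p i) = (phat i n \<omega> - p i) * (1 - phat i n \<omega> - p i)"
          by (simp add: algebra_simps)
        also have "\<bar>\<dots>\<bar> \<le> \<bar>phat i n \<omega> - p i\<bar> * 1"
          unfolding abs_mult using ph p[OF i] by (intro mult_left_mono) auto
        finally have "\<bar>phat i n \<omega> * (1 - phat i n \<omega>) - p i * (1 - p i)\<bar> \<le> d i" using dev i by force
        then show "\<bar>(c i)\<^sup>2 / m i n * (phat i n \<omega> * (1 - phat i n \<omega>) - p i * (1 - p i))\<bar> \<le> (c i)\<^sup>2 / m i n * d i"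
          unfolding abs_mult by (intro mult_mono) auto
      qed
      also have "\<dots> = e * contrast_var c n"
        unfolding contrast_var_def d_def sum_distrib_left by (intro sum.cong) auto
      finally have "\<bar>contrast_var_hat c n \<omega> - contrast_var c n\<bar> \<le> e * contrast_var c n" .
      moreover have "contrast_var_hat c n \<omega> / contrast_var c n - 1 = (contrast_var_hat c n \<omega> - contrast_var c n) / contrast_var c n"
        using V by (simp add: diff_divide_distrib)
      ultimately show ?thesis using V by (simp add: pos_divide_le_eq)
    qed
    have "AE \<omega> in M n. \<forall>i\<in>J. A i n \<omega> \<le> m i n"
      using finite_J AE_A_le by (intro AE_finite_allI) auto
    then have "AE \<omega> in M n. \<omega> \<in> {\<omega> \<in> space (M n). e < \<bar>contrast_var_hat c n \<omega> / contrast_var c n - 1\<bar>}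
        \<longrightarrow> \<omega> \<in> (\<Union>i\<in>J. ?dev i n)"
    proof eventually_elim
      case (elim \<omega>)
      then show ?case using close[of \<omega>] by (auto simp: not_less[symmetric])
    qed
    then have "measure (M n) {\<omega> \<in> space (M n). e < \<bar>contrast_var_hat c n \<omega> / contrast_var c n - 1\<bar>}
        \<le> measure (M n) (\<Union>i\<in>J. ?dev i n)"
      using finite_J by (intro finite_measure_mono_AE sets.finite_UN) auto
    also have "\<dots> \<le> (\<Sum>i\<in>J. measure (M n) (?dev i n))"
      using finite_J by (intro finite_measure_subadditive_finite) auto
    finally show ?thesis .
  qed
  have "(\<lambda>n. \<Sum>i\<in>J. measure (M n) (?dev i n)) \<longlonglongrightarrow> 0"
    by (intro tendsto_null_sum phat_tendsto_in_prob d)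
  then show ?thesis
    by (rule tendsto_sandwich[OF _ _ tendsto_const, rotated 2])
      (simp_all add: eventually_mono[OF eventually_m_pos bound])
qed

text \<open>A central limit theorem by way of Levy's continuity theorem. The \<open>i\<close>-th factor of the
  characteristic function at \<open>t\<close> is close to \<open>exp (- w i / 2)\<close>, where \<open>w i\<close> is \<open>t\<^sup>2\<close> times the share of the
  \<open>i\<close>-th group in the total variance. The shares vary with \<open>n\<close> but always add up to 1, so that the
  product of the Gaussian factors is \<open>exp (- t\<^sup>2 / 2)\<close>.\<close>
lemma standardized_contrast_weak_conv:
  assumes J: "J \<noteq> {}" and c: "\<And>i. i \<in> J \<Longrightarrow> c i \<noteq> 0"
  shows "weak_conv_m (\<lambda>n. distr (M n) borel (\<lambda>\<omega>. (\<Sum>i\<in>J. c i * (phat i n \<omega> - p i)) / sqrt (contrast_var c n)))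
    std_normal_distribution"
    (is "weak_conv_m (\<lambda>n. distr (M n) borel (?S n)) _")
proof (rule levy_continuity)
  show "real_distribution (distr (M n) borel (?S n))" for n
    using prob[of n] by (intro prob_space.real_distribution_distr) auto
  show "real_distribution std_normal_distribution" by (rule real_dist_normal_dist)
  fix t :: real
  define B where "B n = (\<Sum>i\<in>J. \<bar>t\<bar> ^ 3 / (6 * sqrt (real (m i n) * (p i * (1 - p i)))) + t ^ 4 / (8 * real (m i n)))" for n
  have "cmod (char (distr (M n) borel (?S n)) t - complex_of_real (exp (- (t\<^sup>2) / 2))) \<le> B n"
    if m: "\<forall>i\<in>J. 0 < m i n" for n
  proof -
    interpret prob_space "M n" by (rule prob)
    define V where "V = contrast_var c n"
    have V: "0 < V" unfolding V_def using J c m by (intro contrast_var_pos) auto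
    define b where "b i = c i / (real (m i n) * sqrt V)" for i
    define w where "w i = real (m i n) * (p i * (1 - p i)) * (t * b i)\<^sup>2" for i
    have w_eq: "w i = t\<^sup>2 * ((c i)\<^sup>2 * (p i * (1 - p i)) / real (m i n)) / V" if "i \<in> J" for i
    proof -
      have "(b i)\<^sup>2 = (c i)\<^sup>2 / ((real (m i n))\<^sup>2 * V)"
        using V by (simp add: b_def power_divide power_mult_distrib)
      then show ?thesis
        unfolding w_def power_mult_distrib using m that V by (simp add: power2_eq_square[of "real (m i n)"])
    qed
    have sum_w: "(\<Sum>i\<in>J. w i) = t\<^sup>2"
    proof -
      have "(\<Sum>i\<in>J. w i) = t\<^sup>2 * contrast_var c n / V"
        unfolding contrast_var_def sum_distrib_left sum_divide_distrib by (rule sum.cong[OF refl w_eq])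
      then show ?thesis using V by (simp add: V_def)
    qed
    have w_nonneg: "0 \<le> w i" if "i \<in> J" for i using p[OF that] by (simp add: w_def)
    have w_le: "w i \<le> t\<^sup>2" if "i \<in> J" for i
      unfolding sum_w[symmetric] using finite_J w_nonneg that by (intro member_le_sum) auto
    have "?S n \<omega> = (\<Sum>i\<in>J. b i * (real (A i n \<omega>) - real (m i n) * p i))" for \<omega>
      unfolding V_def[symmetric] sum_divide_distrib
    proof (rule sum.cong[OF refl])
      fix i assume "i \<in> J"
      then show "c i * (phat i n \<omega> - p i) / sqrt V = b i * (real (A i n \<omega>) - real (m i n) * p i)"
        using m by (auto simp: b_def phat_def right_diff_distrib diff_divide_distrib)
    qed
    then have "char (distr (M n) borel (?S n)) t
        = char (distr (M n) borel (\<lambda>\<omega>. \<Sum>i\<in>J. b i * (real (A i n \<omega>) - real (m i n) * p i))) t" by simp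
    also have "\<dots> = (\<Prod>i\<in>J. char (distr (M n) borel (\<lambda>\<omega>. b i * (real (A i n \<omega>) - real (m i n) * p i))) t)"
      by (intro char_distr_sum indep_vars_compose2[OF indep]) auto
    also have "\<dots> = (\<Prod>i\<in>J. centered_bernoulli_char (p i) (t * b i) ^ m i n)"
      by (intro prod.cong refl char_centered_binomial binomial measurable_A) (use p in \<open>auto intro: less_imp_le\<close>)
    finally have char_eq: "char (distr (M n) borel (?S n)) t = (\<Prod>i\<in>J. centered_bernoulli_char (p i) (t * b i) ^ m i n)" .
    have "exp (- (t\<^sup>2) / 2) = exp (\<Sum>i\<in>J. - (w i / 2))"
      unfolding sum_w[symmetric] by (simp add: sum_negf sum_divide_distrib)
    also have "\<dots> = (\<Prod>i\<in>J. exp (- (w i / 2)))" by (rule exp_sum[OF finite_J])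
    finally have exp_eq: "complex_of_real (exp (- (t\<^sup>2) / 2)) = (\<Prod>i\<in>J. complex_of_real (exp (- (w i / 2))))"
      by simp
    have "cmod ((\<Prod>i\<in>J. centered_bernoulli_char (p i) (t * b i) ^ m i n) - (\<Prod>i\<in>J. complex_of_real (exp (- (w i / 2)))))
        \<le> (\<Sum>i\<in>J. cmod (centered_bernoulli_char (p i) (t * b i) ^ m i n - complex_of_real (exp (- (w i / 2)))))"
      using p w_nonneg
      by (intro norm_prod_diff) (auto simp: norm_power less_imp_le intro!: power_le_one norm_centered_bernoulli_char_le_1)
    also have "\<dots> \<le> B n"
      unfolding B_def w_def
      using p w_le by (intro sum_mono centered_bernoulli_char_power_approx) (auto simp: w_def)
    finally show ?thesis unfolding char_eq exp_eq .
  qed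
  then have "\<forall>\<^sub>F n in sequentially. cmod (char (distr (M n) borel (?S n)) t - complex_of_real (exp (- (t\<^sup>2) / 2))) \<le> B n"
    by (rule eventually_mono[OF eventually_m_pos])
  moreover have "B \<longlonglongrightarrow> 0"
    unfolding B_def
  proof (intro tendsto_null_sum tendsto_add_zero)
    fix i assume i: "i \<in> J"
    have "filterlim (\<lambda>n. p i * (1 - p i) * real (m i n)) at_top sequentially"
      by (intro filterlim_tendsto_pos_mult_at_top[OF tendsto_const] variance_pos real_m_unbounded i)
    then have "filterlim (\<lambda>n. 6 * sqrt (real (m i n) * (p i * (1 - p i)))) at_top sequentially"
      by (intro filterlim_tendsto_pos_mult_at_top[OF tendsto_const] filterlim_compose[OF sqrt_at_top])
        (simp_all add: mult_ac)
    then show "(\<lambda>n. \<bar>t\<bar> ^ 3 / (6 * sqrt (real (m i n) * (p i * (1 - p i))))) \<longlonglongrightarrow> 0"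
      by (intro tendsto_divide_0[OF tendsto_const] filterlim_at_top_imp_at_infinity)
    show "(\<lambda>n. t ^ 4 / (8 * real (m i n))) \<longlonglongrightarrow> 0"
      by (intro tendsto_divide_0[OF tendsto_const] filterlim_at_top_imp_at_infinity
          filterlim_tendsto_pos_mult_at_top[OF tendsto_const] real_m_unbounded i) auto
  qed
  ultimately have "(\<lambda>n. char (distr (M n) borel (?S n)) t - complex_of_real (exp (- (t\<^sup>2) / 2))) \<longlonglongrightarrow> 0"
    by (rule Lim_null_comparison)
  then show "(\<lambda>n. char (distr (M n) borel (?S n)) t) \<longlonglongrightarrow> char std_normal_distribution t"
    by (simp add: char_std_normal_distribution LIM_zero_iff)
qed

text \<open>The exact variance cancels from the quotient of the squared standardized contrast and the ratio
  of the variances.\<close>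
theorem wald_statistic_weak_conv:
  assumes J: "J \<noteq> {}" and c: "\<And>i. i \<in> J \<Longrightarrow> c i \<noteq> 0"
  shows "weak_conv_m (\<lambda>n. distr (M n) borel (\<lambda>\<omega>. (\<Sum>i\<in>J. c i * (phat i n \<omega> - p i))\<^sup>2 / contrast_var_hat c n \<omega>))
    (chi_squared_distribution 1)"
proof -
  interpret std: real_distribution std_normal_distribution by (rule real_dist_normal_dist)
  let ?S = "\<lambda>n \<omega>. (\<Sum>i\<in>J. c i * (phat i n \<omega> - p i)) / sqrt (contrast_var c n)"
  have S: "real_distribution (distr (M n) borel (?S n))" for n
    using prob[of n] by (intro prob_space.real_distribution_distr) auto
  have "weak_conv_m (\<lambda>n. distr (distr (M n) borel (?S n)) borel (\<lambda>x. x\<^sup>2)) (distr std_normal_distribution borel (\<lambda>x. x\<^sup>2))"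
    by (intro weak_conv_m_distr_continuous S standardized_contrast_weak_conv J c) (auto intro: std.real_distribution_axioms)
  then have "weak_conv_m (\<lambda>n. distr (M n) borel (\<lambda>\<omega>. (?S n \<omega>)\<^sup>2)) (chi_squared_distribution 1)"
    by (simp add: distr_distr comp_def chi_squared_distribution_1[simplified])
  then have *: "weak_conv_m (\<lambda>n. distr (M n) borel (\<lambda>\<omega>. (?S n \<omega>)\<^sup>2 / (contrast_var_hat c n \<omega> / contrast_var c n)))
      (chi_squared_distribution 1)"
    by (intro weak_conv_m_divide prob contrast_var_ratio_tendsto_1 J c)
      (auto simp: chi_squared_distribution_1[simplified] intro: std.real_distribution_distr)
  show ?thesis
  proof (rule weak_conv_m_cong_eventually[OF _ *])
    show "\<forall>\<^sub>F n in sequentially.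
        distr (M n) borel (\<lambda>\<omega>. (\<Sum>i\<in>J. c i * (phat i n \<omega> - p i))\<^sup>2 / contrast_var_hat c n \<omega>)
        = distr (M n) borel (\<lambda>\<omega>. (?S n \<omega>)\<^sup>2 / (contrast_var_hat c n \<omega> / contrast_var c n))"
      using eventually_m_pos
    proof eventually_elim
      case (elim n)
      then have "0 < contrast_var c n" using J c by (intro contrast_var_pos) auto
      then show ?case by (simp add: power_divide)
    qed
  qed
qed

end

section \<open>The net chi-squared statistic\<close>

lemma proportion_variance_nonneg:
  fixes a m :: nat
  assumes "a \<le> m"
  shows "0 \<le> real a / real m * (1 - real a / real m)"
  using assms by (cases "m = 0") auto

text \<open>The common factor \<open>g = 1 / (n\<^sub>1 u\<^sub>1) + 1 / (n\<^sub>2 u\<^sub>2)\<close> of numerator and denominator cancels. The bounds on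
  the counts make \<open>u\<^sub>1\<close> and \<open>u\<^sub>2\<close> nonnegative; then \<open>g\<close>, with division by zero yielding zero, vanishes only if
  both do, and in that case the two sides are zero. For general counts \<open>u\<^sub>1\<close> and \<open>u\<^sub>2\<close> could have
  opposite signs, and the equation could fail.\<close>
lemma chi2_net_eq_wald_statistic:
  fixes N K aT aC :: "nat \<Rightarrow> nat"
  assumes N: "\<And>i. i \<in> {1, 2} \<Longrightarrow> 0 < N i"
    and aT: "\<And>i. i \<in> {1, 2} \<Longrightarrow> aT i \<le> N i" and aC: "\<And>i. i \<in> {1, 2} \<Longrightarrow> aC i \<le> K i"
  shows "chi2_net N K aT aC =
    ((pT_hat N aT 1 - pC_hat K aC 1) - (pT_hat N aT 2 - pC_hat K aC 2))\<^sup>2 /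
    (\<Sum>i\<in>{1, 2}. pT_hat N aT i * (1 - pT_hat N aT i) / N i + pC_hat K aC i * (1 - pC_hat K aC i) / K i)"
proof -
  define n1 n2 where "n1 = real (N 1)" and "n2 = real (N 2)"
  define u where "u i = unit_var_hat N K aT aC i" for i
  define d where "d i = pT_hat N aT i - pC_hat K aC i" for i
  define h where "h = n1 * n2 / (n1 + n2)"
  define g where "g = 1 / (n1 * u 1) + 1 / (n2 * u 2)"
  define D where "D = u 1 / n1 + u 2 / n2"
  have n: "0 < n1" "0 < n2" using N[of 1] N[of 2] by (auto simp: n1_def n2_def)
  have h: "0 < h" using n by (simp add: h_def)
  have u: "0 \<le> u i" if "i \<in> {1, 2}" for i
    unfolding u_def unit_var_hat_def pT_hat_def pC_hat_def mult.assoc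
    using proportion_variance_nonneg aT[OF that] aC[OF that]
    by (intro add_nonneg_nonneg mult_nonneg_nonneg[of "real (N i) / real (K i)"]) simp_all
  have "add_responses N K aT aC i = N i * d i" if "i \<in> {1, 2}" for i
    using N[OF that] by (simp add: add_responses_def d_def pT_hat_def pC_hat_def algebra_simps)
  from this[of 1] this[of 2]
  have l: "add_responses N K aT aC 1 = n1 * d 1" "add_responses N K aT aC 2 = n2 * d 2"
    by (simp_all add: n1_def n2_def)
  have share: "target_share N 1 = n1 / (n1 + n2)" "target_share N 2 = n2 / (n1 + n2)"
    by (simp_all add: target_share_def n1_def n2_def)
  have D_overall: "pT_overall N aT - pC_overall N K aC = (n1 * d 1 + n2 * d 2) / (n1 + n2)"
    unfolding pT_overall_def pC_overall_def share d_def
    by (simp add: add_divide_distrib diff_divide_distrib algebra_simps)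
  have num: "add_responses N K aT aC 1 - e_hat N K aT aC 1 = h * (d 1 - d 2)"
      "add_responses N K aT aC 2 - e_hat N K aT aC 2 = - (h * (d 1 - d 2))"
    unfolding e_hat_def D_overall l n1_def[symmetric] n2_def[symmetric] h_def
    using n by (simp_all add: field_simps)
  have "v_hat N K aT aC i = N i * u i" for i
    by (simp add: v_hat_def u_def unit_var_hat_def power2_eq_square distrib_left)
  then have v: "v_hat N K aT aC 1 = n1 * u 1" "v_hat N K aT aC 2 = n2 * u 2"
    by (simp_all add: n1_def n2_def)
  have w: "w_hat N K aT aC = h * D"
    unfolding w_hat_def share u_def[symmetric] h_def D_def using n by (simp add: distrib_left)
  have f: "f_hat N K aT aC = h * g"
    unfolding f_hat_def share u_def[symmetric] h_def g_def using n by (simp add: distrib_left)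
  have "chi2_net N K aT aC = (h * (d 1 - d 2))\<^sup>2 * g * (1 / (h * D * (h * g)))"
    unfolding chi2_net_def num v w f by (simp add: g_def distrib_left)
  also have "\<dots> = (d 1 - d 2)\<^sup>2 / D"
  proof (cases "g = 0")
    case True
    have "0 \<le> 1 / (n1 * u 1)" "0 \<le> 1 / (n2 * u 2)" using n u by simp_all
    then have "u 1 = 0 \<and> u 2 = 0"
      using True n by (simp add: g_def add_nonneg_eq_0_iff)
    then show ?thesis by (simp add: D_def)
  next
    case False
    then show ?thesis using h by (simp add: power_mult_distrib power2_eq_square)
  qed
  also have "D = (\<Sum>i\<in>{1, 2}. u i / N i)" by (simp add: D_def n1_def n2_def)
  also have "\<dots> = (\<Sum>i\<in>{1, 2}. pT_hat N aT i * (1 - pT_hat N aT i) / N i + pC_hat K aC i * (1 - pC_hat K aC i) / K i)"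
  proof (rule sum.cong[OF refl])
    fix i :: nat assume "i \<in> {1, 2}"
    then have "N i \<noteq> 0" using N by force
    then show "u i / N i = pT_hat N aT i * (1 - pT_hat N aT i) / N i + pC_hat K aC i * (1 - pC_hat K aC i) / K i"
      by (simp add: u_def unit_var_hat_def add_divide_distrib)
  qed
  finally show ?thesis by (simp add: d_def)
qed

lemma filterlim_at_top_of_ratio:
  fixes f g :: "nat \<Rightarrow> nat"
  assumes ratio: "(\<lambda>n. real (f n) / real (g n)) \<longlonglongrightarrow> l" and l: "0 < l"
  shows filterlim_denominator_at_top: "filterlim f at_top sequentially \<Longrightarrow> filterlim g at_top sequentially"
    and filterlim_numerator_at_top: "filterlim g at_top sequentially \<Longrightarrow> filterlim f at_top sequentially"
proof -
  have pos: "\<forall>\<^sub>F n in sequentially. 0 < real (f n) / real (g n)"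
    by (rule order_tendstoD(1)[OF ratio l])
  {
    assume f: "filterlim f at_top sequentially"
    have "filterlim (\<lambda>n. inverse (real (f n) / real (g n)) * real (f n)) at_top sequentially"
      using l by (intro filterlim_tendsto_pos_mult_at_top[OF tendsto_inverse[OF ratio]]
          filterlim_compose[OF filterlim_real_sequentially f]) auto
    moreover have "\<forall>\<^sub>F n in sequentially. inverse (real (f n) / real (g n)) * real (f n) = real (g n)"
      using pos by eventually_elim (auto simp: zero_less_divide_iff)
    ultimately have "filterlim (\<lambda>n. real (g n)) at_top sequentially"
      by (rule filterlim_cong[OF refl refl, THEN iffD1, rotated])
    then show "filterlim g at_top sequentially" by (simp add: filterlim_sequentially_iff_filterlim_real)
  next
    assume g: "filterlim g at_top sequentially"
    have "filterlim (\<lambda>n. real (f n) / real (g n) * real (g n)) at_top sequentially"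
      by (intro filterlim_tendsto_pos_mult_at_top[OF ratio l] filterlim_compose[OF filterlim_real_sequentially g])
    moreover have "\<forall>\<^sub>F n in sequentially. real (f n) / real (g n) * real (g n) = real (f n)"
      using pos by eventually_elim (auto simp: zero_less_divide_iff)
    ultimately have "filterlim (\<lambda>n. real (f n)) at_top sequentially"
      by (rule filterlim_cong[OF refl refl, THEN iffD1, rotated])
    then show "filterlim f at_top sequentially" by (simp add: filterlim_sequentially_iff_filterlim_real)
  }
qed

theorem theorem4p1:
  fixes M :: "nat \<Rightarrow> 'a measure"
    and N K :: "nat \<Rightarrow> nat \<Rightarrow> nat"
    and k :: "nat \<Rightarrow> nat"
    and aT aC :: "nat \<Rightarrow> nat \<Rightarrow> 'a \<Rightarrow> nat"
    and pT pC :: "nat \<Rightarrow> real"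
    and s t1 t2 :: real
  assumes prob: "\<And>n. prob_space (M n)"
    and total_target: "\<And>n. N 1 n + N 2 n = n"
    and total_control: "\<And>n. k n = K 1 n + K 2 n"
    and indep: "\<And>n. prob_space.indep_vars (M n) (\<lambda>_. count_space UNIV)
          (case_sum (\<lambda>i. aT i n) (\<lambda>i. aC i n)) ({1, 2} <+> {1, 2})"
    and binomial_T: "\<And>i n. i \<in> {1, 2} \<Longrightarrow>
          distr (M n) (count_space UNIV) (aT i n) = measure_pmf (binomial_pmf (N i n) (pT i))"
    and binomial_C: "\<And>i n. i \<in> {1, 2} \<Longrightarrow>
          distr (M n) (count_space UNIV) (aC i n) = measure_pmf (binomial_pmf (K i n) (pC i))"
    and pT: "\<And>i. i \<in> {1, 2} \<Longrightarrow> 0 < pT i \<and> pT i < 1"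
    and pC: "\<And>i. i \<in> {1, 2} \<Longrightarrow> 0 < pC i \<and> pC i < 1"
    and null_hypothesis: "pT 1 - pC 1 = pT 2 - pC 2"
    and lim_s: "(\<lambda>n. real (N 1 n) / real n) \<longlonglongrightarrow> s" "s > 0"
    and lim_t1: "(\<lambda>n. real (N 1 n) / real (K 1 n)) \<longlonglongrightarrow> t1" "t1 > 0"
    and lim_t2: "(\<lambda>n. real (N 2 n) / real (K 2 n)) \<longlonglongrightarrow> t2" "t2 > 0"
    and N2_unbounded: "filterlim (N 2) at_top sequentially"
  shows "weak_conv_m
          (\<lambda>n. distr (M n) borel
             (\<lambda>\<omega>. chi2_net (\<lambda>i. N i n) (\<lambda>i. K i n) (\<lambda>i. aT i n \<omega>) (\<lambda>i. aC i n \<omega>)))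
          (chi_squared_distribution 1)"
proof -
  \<comment> \<open>The four groups form the index set of a single family of samples: \<open>Inl i\<close> is the target group and
    \<open>Inr i\<close> the control group of subgroup \<open>i\<close>. The contrast \<open>c\<close> is the difference of the uplifts.\<close>
  define J :: "(nat + nat) set" where "J = {1, 2} <+> {1, 2}"
  define A where "A j n = case_sum (\<lambda>i. aT i n) (\<lambda>i. aC i n) j" for j :: "nat + nat" and n
  define m where "m = case_sum N K"
  define p where "p = case_sum pT pC"
  define c :: "nat + nat \<Rightarrow> real" where
    "c = case_sum (\<lambda>i. if i = 1 then 1 else - 1) (\<lambda>i. if i = 1 then - 1 else 1)"
  have N1: "filterlim (N 1) at_top sequentially"
    by (rule filterlim_numerator_at_top[OF lim_s filterlim_ident])
  have size: "filterlim (N i) at_top sequentially \<and> filterlim (K i) at_top sequentially" if "i \<in> {1, 2}" for i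
    using that N1 N2_unbounded filterlim_denominator_at_top[OF lim_t1 N1]
      filterlim_denominator_at_top[OF lim_t2 N2_unbounded] by auto
  interpret binomial_samples M J A m p
  proof (rule binomial_samples.intro)
    show "prob_space (M n)" for n by (rule prob)
    show "finite J" by (simp add: J_def)
    show "prob_space.indep_vars (M n) (\<lambda>_. count_space UNIV) (\<lambda>j. A j n) J" for n
      using indep[of n] by (simp add: A_def J_def)
    show "distr (M n) (count_space UNIV) (A j n) = measure_pmf (binomial_pmf (m j n) (p j))" if "j \<in> J" for j n
      using that binomial_T binomial_C by (auto simp: J_def A_def m_def p_def)
    show "filterlim (m j) at_top sequentially" if "j \<in> J" for j
      using that size by (auto simp: J_def m_def)
    show "0 < p j \<and> p j < 1" if "j \<in> J" for j
      using that pT pC by (auto simp: J_def p_def)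
  qed
  have sum_J: "(\<Sum>j\<in>J. F j) = F (Inl 1) + F (Inl 2) + F (Inr 1) + F (Inr 2)" for F :: "nat + nat \<Rightarrow> real"
    by (simp add: J_def sum.Plus)
  have wald: "weak_conv_m (\<lambda>n. distr (M n) borel (\<lambda>\<omega>. (\<Sum>j\<in>J. c j * (phat j n \<omega> - p j))\<^sup>2 / contrast_var_hat c n \<omega>))
      (chi_squared_distribution 1)"
    by (rule wald_statistic_weak_conv) (auto simp: J_def c_def)
  show ?thesis
  proof (rule weak_conv_m_cong_eventually[OF _ wald])
    show "\<forall>\<^sub>F n in sequentially.
        distr (M n) borel (\<lambda>\<omega>. chi2_net (\<lambda>i. N i n) (\<lambda>i. K i n) (\<lambda>i. aT i n \<omega>) (\<lambda>i. aC i n \<omega>))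
        = distr (M n) borel (\<lambda>\<omega>. (\<Sum>j\<in>J. c j * (phat j n \<omega> - p j))\<^sup>2 / contrast_var_hat c n \<omega>)"
      using eventually_m_pos
    proof eventually_elim
      case (elim n)
      have pos: "0 < N i n" if "i \<in> {1, 2}" for i
        using elim that by (force simp: J_def m_def)
      have phat_eq: "pT_hat (\<lambda>i. N i n) (\<lambda>i. aT i n \<omega>) i = phat (Inl i) n \<omega>"
          "pC_hat (\<lambda>i. K i n) (\<lambda>i. aC i n \<omega>) i = phat (Inr i) n \<omega>" for i \<omega>
        unfolding phat_def pT_hat_def pC_hat_def by (simp_all add: A_def m_def)
      have contrast: "(\<Sum>j\<in>J. c j * (phat j n \<omega> - p j))
          = (phat (Inl 1) n \<omega> - phat (Inr 1) n \<omega>) - (phat (Inl 2) n \<omega> - phat (Inr 2) n \<omega>)" for \<omega>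
        using null_hypothesis by (simp add: sum_J c_def p_def)
      have var: "contrast_var_hat c n \<omega> = (\<Sum>i\<in>{1, 2}.
          phat (Inl i) n \<omega> * (1 - phat (Inl i) n \<omega>) / N i n + phat (Inr i) n \<omega> * (1 - phat (Inr i) n \<omega>) / K i n)" for \<omega>
        unfolding contrast_var_hat_def sum_J by (simp add: c_def m_def)
      have "AE \<omega> in M n. \<forall>j\<in>J. A j n \<omega> \<le> m j n"
        using finite_J AE_A_le by (intro AE_finite_allI) auto
      then have "AE \<omega> in M n. chi2_net (\<lambda>i. N i n) (\<lambda>i. K i n) (\<lambda>i. aT i n \<omega>) (\<lambda>i. aC i n \<omega>)
          = (\<Sum>j\<in>J. c j * (phat j n \<omega> - p j))\<^sup>2 / contrast_var_hat c n \<omega>"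
      proof eventually_elim
        case (elim \<omega>)
        have "aT i n \<omega> \<le> N i n" "aC i n \<omega> \<le> K i n" if "i \<in> {1, 2}" for i
        proof -
          have "Inl i \<in> J" "Inr i \<in> J" using that by (auto simp: J_def)
          with elim have "A (Inl i) n \<omega> \<le> m (Inl i) n" "A (Inr i) n \<omega> \<le> m (Inr i) n" by blast+
          then show "aT i n \<omega> \<le> N i n" "aC i n \<omega> \<le> K i n" by (simp_all add: A_def m_def)
        qed
        note le = this
        have "chi2_net (\<lambda>i. N i n) (\<lambda>i. K i n) (\<lambda>i. aT i n \<omega>) (\<lambda>i. aC i n \<omega>)
            = ((phat (Inl 1) n \<omega> - phat (Inr 1) n \<omega>) - (phat (Inl 2) n \<omega> - phat (Inr 2) n \<omega>))\<^sup>2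
              / contrast_var_hat c n \<omega>"
          unfolding var phat_eq[symmetric]
          by (rule chi2_net_eq_wald_statistic) (fact pos le)+
        then show ?case unfolding contrast .
      qed
      moreover have "(\<lambda>\<omega>. chi2_net (\<lambda>i. N i n) (\<lambda>i. K i n) (\<lambda>i. aT i n \<omega>) (\<lambda>i. aC i n \<omega>)) \<in> borel_measurable (M n)"
      proof -
        have "Inl 1 \<in> J" "Inl 2 \<in> J" "Inr 1 \<in> J" "Inr 2 \<in> J" by (auto simp: J_def)
        from this[THEN measurable_A[of _ n]]
        have [measurable]: "aT 1 n \<in> measurable (M n) (count_space UNIV)" "aT 2 n \<in> measurable (M n) (count_space UNIV)"
            "aC 1 n \<in> measurable (M n) (count_space UNIV)" "aC 2 n \<in> measurable (M n) (count_space UNIV)"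
          by (simp_all add: A_def)
        show ?thesis
          unfolding chi2_net_def add_responses_def e_hat_def v_hat_def w_hat_def f_hat_def unit_var_hat_def
            pT_overall_def pC_overall_def pT_hat_def pC_hat_def target_share_def by measurable
      qed
      ultimately show ?case by (intro distr_cong_AE) auto
    qed
  qed
qed

end
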